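(* The mesh patterns $$m_1=(12,\{(0,1),(0,2),(2,0),(2,1)\})\quad\text{and}\quad m_2=(12,\{(0,1),(0,2),(1,1),(2,0),(2,1)\})$$ are coincident under $321$, i.e. $\mathrm{Av}(\{321,m_1\})=\mathrm{Av}(\{321,m_2\})$.
   Context: Write $[n]=\{1,\dots,n\}$. A permutation of length $n$ is a bijection of $[n]$, written in one-line notation; $G(\pi)=\{(i,\pi(i)) : i\in[n]\}$ is its plot. A mesh pattern of length $k$ is a pair $p=(\tau,R)$ with $\tau$ a permutation of length $k$ and $R\subseteq\{0,\dots,k\}^2$. An occurrence of $p$ in a permutation $\pi$ of length $n$ is a subset $\omega\subseteq G(\pi)$ for which there are order-preserving injections $\alpha,\beta:[k]\to[n]$ such that (i) $\omega=\{(\alpha(i),\beta(j)):(i,j)\in G(\tau)\}$, and (ii) with $\alpha(0)=\beta(0)=0$, $\alpha(k+1)=\beta(k+1)=n+1$ and $R_{ij}=[\alpha(i)+1,\alpha(i+1)-1]\times[\beta(j)+1,\beta(j+1)-1]$, one has $R_{ij}\cap G(\pi)=\emptyset$ for every $(i,j)\in R$. A permutation avoids $p$ if it has no occurrence of $p$. A classical pattern $\pi$ is identified with the mesh pattern $(\pi,\emptyset)$. $\mathrm{Av}(S)$ is the set of all permutations (of all lengths) avoiding every pattern in $S$. *)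

theory Defs
  imports "HOL-Combinatorics.Multiset_Permutations"
begin

text \<open>
  A permutation of length \<open>n\<close> is its one-line notation: a list that enumerates
  \<open>{1..n}\<close> without repetition. The empty permutation is included.
\<close>

definition is_perm :: "nat list \<Rightarrow> bool" where
  "is_perm \<pi> \<longleftrightarrow> \<pi> \<in> permutations_of_set {1..length \<pi>}"

text \<open>The plot uses indices from 1, whereas list indices start at 0.\<close>

definition plot :: "nat list \<Rightarrow> (nat \<times> nat) set" where
  "plot \<pi> = {(i, \<pi> ! (i - 1)) | i. i \<in> {1..length \<pi>}}"

type_synonym mesh_pattern = "nat list \<times> (nat \<times> nat) set"

definition is_mesh_pattern :: "mesh_pattern \<Rightarrow> bool" where
  "is_mesh_pattern p \<longleftrightarrow>
     (case p of (\<tau>, R) \<Rightarrow> is_perm \<tau> \<and> R \<subseteq> {0..length \<tau>} \<times> {0..length \<tau>})"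

definition mesh_box :: "(nat \<Rightarrow> nat) \<Rightarrow> (nat \<Rightarrow> nat) \<Rightarrow> nat \<Rightarrow> nat \<Rightarrow> (nat \<times> nat) set" where
  "mesh_box \<alpha> \<beta> i j = {\<alpha> i + 1..\<alpha> (i + 1) - 1} \<times> {\<beta> j + 1..\<beta> (j + 1) - 1}"

text \<open>
  The injections \<open>[k] \<rightarrow> [n]\<close> are total functions on the naturals; their values at \<open>0\<close> and
  \<open>k + 1\<close> are fixed by the boundary convention, the values beyond \<open>k + 1\<close> are irrelevant.
\<close>

definition is_occurrence :: "mesh_pattern \<Rightarrow> nat list \<Rightarrow> (nat \<times> nat) set \<Rightarrow> bool" where
  "is_occurrence p \<pi> \<omega> \<longleftrightarrow>
     (case p of (\<tau>, R) \<Rightarrow>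
       let k = length \<tau>; n = length \<pi> in
       \<omega> \<subseteq> plot \<pi> \<and>
       (\<exists>\<alpha> \<beta> :: nat \<Rightarrow> nat.
          strict_mono_on {1..k} \<alpha> \<and> \<alpha> ` {1..k} \<subseteq> {1..n} \<and>
          strict_mono_on {1..k} \<beta> \<and> \<beta> ` {1..k} \<subseteq> {1..n} \<and>
          \<alpha> 0 = 0 \<and> \<beta> 0 = 0 \<and> \<alpha> (k + 1) = n + 1 \<and> \<beta> (k + 1) = n + 1 \<and>
          \<omega> = {(\<alpha> i, \<beta> j) | i j. (i, j) \<in> plot \<tau>} \<and>
          (\<forall>(i, j) \<in> R. mesh_box \<alpha> \<beta> i j \<inter> plot \<pi> = {})))"

definition avoids :: "nat list \<Rightarrow> mesh_pattern \<Rightarrow> bool" where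
  "avoids \<pi> p \<longleftrightarrow> \<not> (\<exists>\<omega>. is_occurrence p \<pi> \<omega>)"

definition Av :: "mesh_pattern set \<Rightarrow> nat list set" where
  "Av S = {\<pi>. is_perm \<pi> \<and> (\<forall>p \<in> S. avoids \<pi> p)}"

definition classical :: "nat list \<Rightarrow> mesh_pattern" where
  "classical \<tau> = (\<tau>, {})"

definition m1 :: mesh_pattern where
  "m1 = ([1, 2], {(0, 1), (0, 2), (2, 0), (2, 1)})"

definition m2 :: mesh_pattern where
  "m2 = ([1, 2], {(0, 1), (0, 2), (1, 1), (2, 0), (2, 1)})"

lemma is_mesh_pattern_classical_321: "is_mesh_pattern (classical [3, 2, 1])"
  by (auto simp: is_mesh_pattern_def classical_def is_perm_def permutations_of_set_def)

lemma is_mesh_pattern_m1: "is_mesh_pattern m1"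
  by (auto simp: is_mesh_pattern_def m1_def is_perm_def permutations_of_set_def)

lemma is_mesh_pattern_m2: "is_mesh_pattern m2"
  by (auto simp: is_mesh_pattern_def m2_def is_perm_def permutations_of_set_def)

end

theory Submission
  imports Defs
begin

text \<open>
  An occurrence of \<open>m1\<close> is a left-to-right maximum lying to the lower left of a right-to-left
  minimum; \<open>m2\<close> asks in addition that no point lies in the open rectangle between the two. In a
  321-avoiding permutation every point is a left-to-right maximum or a right-to-left minimum, so
  a point in that rectangle can replace one of the two points of the occurrence. Hence a
  horizontally shortest occurrence of \<open>m1\<close> is an occurrence of \<open>m2\<close>.
\<close>

section \<open>Points of the plot, and occurrences given by explicit points\<close>

lemma plot_bounds:
  assumes "is_perm \<pi>" "(i, p) \<in> plot \<pi>"
  shows "1 \<le> i" "i \<le> length \<pi>" "1 \<le> p" "p \<le> length \<pi>"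
proof -
  have i: "1 \<le> i" "i \<le> length \<pi>" "p = \<pi> ! (i - 1)"
    using assms(2) by (auto simp: plot_def)
  then have "p \<in> set \<pi>" by simp
  then have "p \<in> {1..length \<pi>}"
    using assms(1) by (auto simp: is_perm_def permutations_of_set_def)
  with i show "1 \<le> i" "i \<le> length \<pi>" "1 \<le> p" "p \<le> length \<pi>" by auto
qed

lemma plot_injective:
  assumes "is_perm \<pi>" "(i, p) \<in> plot \<pi>" "(j, p) \<in> plot \<pi>"
  shows "i = j"
proof -
  have "distinct \<pi>"
    using assms(1) by (simp add: is_perm_def permutations_of_set_def)
  moreover have "\<pi> ! (i - 1) = \<pi> ! (j - 1)" "1 \<le> i" "i \<le> length \<pi>" "1 \<le> j" "j \<le> length \<pi>"
    using assms(2,3) by (auto simp: plot_def)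
  ultimately have "i - 1 = j - 1"
    by (simp add: nth_eq_iff_index_eq)
  with \<open>1 \<le> i\<close> \<open>1 \<le> j\<close> show ?thesis by linarith
qed

text \<open>The classical pattern shades no box, so order relations among three points suffice; this
  spares later arguments the embeddings \<open>\<alpha>\<close> and \<open>\<beta>\<close>.\<close>

lemma not_avoids_classical_321:
  assumes perm: "is_perm \<pi>"
    and pts: "(i, p) \<in> plot \<pi>" "(j, q) \<in> plot \<pi>" "(k, r) \<in> plot \<pi>"
    and ord: "i < j" "j < k" "r < q" "q < p"
  shows "\<not> avoids \<pi> (classical [3, 2, 1])"
proof -
  define n where "n = length \<pi>"
  \<comment> \<open>Both embeddings are lookups in lists that start with the boundary value
    \<open>0\<close> and end with \<open>n + 1\<close>. \<open>\<beta>\<close> must be increasing,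
    so the heights are listed from lowest to highest; the descent comes from the plot of
    \<open>[3, 2, 1]\<close>.\<close>
  define \<alpha> where "\<alpha> = (!) [0, i, j, k, n + 1]"
  define \<beta> where "\<beta> = (!) [0, r, q, p, n + 1]"
  have I: "{1..length [3::nat, 2, 1]} = {1, 2, 3}" by auto
  have plot3: "plot [3, 2, 1] = {(1, 3), (2, 2), (3, 1)}"
    unfolding plot_def I by (auto intro: exI[of _ "2::nat"] exI[of _ "3::nat"])
  have vals: "\<alpha> 0 = 0" "\<alpha> 1 = i" "\<alpha> 2 = j" "\<alpha> 3 = k" "\<alpha> 4 = n + 1"
    "\<beta> 0 = 0" "\<beta> 1 = r" "\<beta> 2 = q" "\<beta> 3 = p" "\<beta> 4 = n + 1"
    by (simp_all add: \<alpha>_def \<beta>_def eval_nat_numeral)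
  have mono: "strict_mono_on {1..length [3::nat, 2, 1]} \<alpha>" "strict_mono_on {1..length [3::nat, 2, 1]} \<beta>"
    unfolding I using ord vals by (auto simp: strict_mono_on_def)
  have ran: "\<alpha> ` {1..length [3::nat, 2, 1]} \<subseteq> {1..n}" "\<beta> ` {1..length [3::nat, 2, 1]} \<subseteq> {1..n}"
    unfolding I using vals plot_bounds[OF perm pts(1)] plot_bounds[OF perm pts(2)]
      plot_bounds[OF perm pts(3)] by (auto simp: n_def)
  have set: "{(i, p), (j, q), (k, r)} = {(\<alpha> a, \<beta> b) | a b. (a, b) \<in> plot [3, 2, 1]}"
    unfolding plot3 using vals by auto
  have "is_occurrence (classical [3, 2, 1]) \<pi> {(i, p), (j, q), (k, r)}"
    unfolding is_occurrence_def classical_def prod.case Let_def n_def[symmetric]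
  proof (intro conjI exI)
    show "\<alpha> (length [3::nat, 2, 1] + 1) = n + 1" "\<beta> (length [3::nat, 2, 1] + 1) = n + 1"
      using vals by (simp_all add: eval_nat_numeral)
    show "{(i, p), (j, q), (k, r)} = {(\<alpha> a, \<beta> b) | a b. (a, b) \<in> plot [3, 2, 1]}"
      by (rule set)
  qed (use pts mono ran vals in auto)
  then show ?thesis by (auto simp: avoids_def)
qed

text \<open>For an underlying pattern \<open>12\<close>, the two points fix both embeddings at
  \<open>1\<close> and \<open>2\<close>, and the convention fixes them at \<open>0\<close> and
  \<open>3\<close>. No shaded box reads any other value, so quantifying over functions reduces to
  quantifying over two points.\<close>

lemma avoids_12_iff:
  assumes perm: "is_perm \<pi>" and R: "R \<subseteq> {0..2} \<times> {0..2}"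
  shows "avoids \<pi> ([1, 2], R) \<longleftrightarrow>
    \<not> (\<exists>i j p q. (i, p) \<in> plot \<pi> \<and> (j, q) \<in> plot \<pi> \<and> i < j \<and> p < q \<and>
        (\<forall>(a, b) \<in> R. mesh_box ((!) [0, i, j, length \<pi> + 1]) ((!) [0, p, q, length \<pi> + 1]) a b
            \<inter> plot \<pi> = {}))"
    (is "_ \<longleftrightarrow> \<not> ?contains")
proof -
  define n where "n = length \<pi>"
  have I: "{1..length [1::nat, 2]} = {1, 2}" by auto
  have len: "length [1::nat, 2] + 1 = 3" by simp
  have plot2: "plot [1, 2] = {(1, 1), (2, 2)}"
    unfolding plot_def I by (auto intro: exI[of _ "2::nat"])
  let ?empty = "\<lambda>\<alpha> \<beta>. \<forall>(a, b) \<in> R. mesh_box \<alpha> \<beta> a b \<inter> plot \<pi> = {}"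
  \<comment> \<open>A box with index \<open>a\<close> reads \<open>\<alpha>\<close> only at
    \<open>a\<close> and \<open>a + 1\<close>, and \<open>R\<close> bounds \<open>a\<close> by
    \<open>2\<close>; likewise for \<open>\<beta>\<close>. Hence arbitrary embeddings may be
    replaced by lists of four values.\<close>
  have boxes: "?empty \<alpha> \<beta> \<longleftrightarrow> ?empty ((!) [0, \<alpha> 1, \<alpha> 2, n + 1]) ((!) [0, \<beta> 1, \<beta> 2, n + 1])"
    if "\<alpha> 0 = 0" "\<beta> 0 = 0" "\<alpha> 3 = n + 1" "\<beta> 3 = n + 1" for \<alpha> \<beta> :: "nat \<Rightarrow> nat"
  proof -
    have "mesh_box \<alpha> \<beta> a b = mesh_box ((!) [0, \<alpha> 1, \<alpha> 2, n + 1]) ((!) [0, \<beta> 1, \<beta> 2, n + 1]) a b"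
      if "(a, b) \<in> R" for a b
    proof -
      have "a = 0 \<or> a = 1 \<or> a = 2" "b = 0 \<or> b = 1 \<or> b = 2"
        using R that by force+
      then show ?thesis
        using \<open>\<alpha> 0 = 0\<close> \<open>\<beta> 0 = 0\<close> \<open>\<alpha> 3 = n + 1\<close> \<open>\<beta> 3 = n + 1\<close>
        by (auto simp: mesh_box_def eval_nat_numeral)
    qed
    then show ?thesis
      by (intro ball_cong refl) (simp only: split_paired_all prod.case)
  qed
  have "?contains" if occ: "is_occurrence ([1, 2], R) \<pi> \<omega>" for \<omega>
  proof -
    from occ obtain \<alpha> \<beta> :: "nat \<Rightarrow> nat" where
      sub: "\<omega> \<subseteq> plot \<pi>" and mono: "strict_mono_on {1, 2} \<alpha>" "strict_mono_on {1, 2} \<beta>"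
      and ends: "\<alpha> 0 = 0" "\<beta> 0 = 0" "\<alpha> 3 = n + 1" "\<beta> 3 = n + 1"
      and \<omega>: "\<omega> = {(\<alpha> i, \<beta> j) | i j. (i, j) \<in> plot [1, 2]}"
      and empty: "?empty \<alpha> \<beta>"
      unfolding is_occurrence_def prod.case Let_def n_def[symmetric] I len
      by - (elim conjE exE, rule that)
    have "(\<alpha> 1, \<beta> 1) \<in> plot \<pi>" "(\<alpha> 2, \<beta> 2) \<in> plot \<pi>"
      using sub unfolding \<omega> plot2 by auto
    moreover have "\<alpha> 1 < \<alpha> 2" "\<beta> 1 < \<beta> 2"
      using mono by (auto simp: strict_mono_on_def)
    moreover have "?empty ((!) [0, \<alpha> 1, \<alpha> 2, n + 1]) ((!) [0, \<beta> 1, \<beta> 2, n + 1])"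
      using empty boxes[OF ends] by (rule iffD1[rotated])
    ultimately show ?thesis
      unfolding n_def
      by - (rule exI[of _ "\<alpha> 1"], rule exI[of _ "\<alpha> 2"], rule exI[of _ "\<beta> 1"],
        rule exI[of _ "\<beta> 2"], intro conjI)
  qed
  moreover have "\<exists>\<omega>. is_occurrence ([1, 2], R) \<pi> \<omega>" if ?contains
  proof -
    from that obtain i j p q where pts: "(i, p) \<in> plot \<pi>" "(j, q) \<in> plot \<pi>"
      and ord: "i < j" "p < q"
      and empty: "?empty ((!) [0, i, j, n + 1]) ((!) [0, p, q, n + 1])"
      unfolding n_def[symmetric] by - (elim conjE exE, rule that, assumption+)
    define \<alpha> where "\<alpha> = (!) [0, i, j, n + 1]"
    define \<beta> where "\<beta> = (!) [0, p, q, n + 1]"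
    have vals: "\<alpha> 0 = 0" "\<alpha> 1 = i" "\<alpha> 2 = j" "\<alpha> 3 = n + 1"
      "\<beta> 0 = 0" "\<beta> 1 = p" "\<beta> 2 = q" "\<beta> 3 = n + 1"
      by (simp_all add: \<alpha>_def \<beta>_def eval_nat_numeral)
    have mono: "strict_mono_on {1, 2} \<alpha>" "strict_mono_on {1, 2} \<beta>"
      using ord vals by (auto simp: strict_mono_on_def)
    have ran: "\<alpha> ` {1, 2} \<subseteq> {1..n}" "\<beta> ` {1, 2} \<subseteq> {1..n}"
      using vals plot_bounds[OF perm pts(1)] plot_bounds[OF perm pts(2)] by (auto simp: n_def)
    have set: "{(i, p), (j, q)} = {(\<alpha> a, \<beta> b) | a b. (a, b) \<in> plot [1, 2]}"
      unfolding plot2 using vals by auto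
    have "is_occurrence ([1, 2], R) \<pi> {(i, p), (j, q)}"
      unfolding is_occurrence_def prod.case Let_def n_def[symmetric] I len
    proof (intro conjI exI)
      show "?empty \<alpha> \<beta>"
        unfolding \<alpha>_def \<beta>_def by (rule empty)
      show "{(i, p), (j, q)} = {(\<alpha> a, \<beta> b) | a b. (a, b) \<in> plot [1, 2]}"
        by (rule set)
    qed (use pts mono ran vals in auto)
    then show ?thesis by (rule exI)
  qed
  ultimately show ?thesis
    unfolding avoids_def by (intro arg_cong[where f = Not] iffI) (erule exE)
qed

section \<open>Shaded boxes expressed through left-to-right maxima and right-to-left minima\<close>

definition lr_max :: "nat list \<Rightarrow> nat \<times> nat \<Rightarrow> bool" where
  "lr_max \<pi> x \<longleftrightarrow> x \<in> plot \<pi> \<and> (\<forall>y \<in> plot \<pi>. fst y < fst x \<longrightarrow> snd y < snd x)"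

definition rl_min :: "nat list \<Rightarrow> nat \<times> nat \<Rightarrow> bool" where
  "rl_min \<pi> x \<longleftrightarrow> x \<in> plot \<pi> \<and> (\<forall>y \<in> plot \<pi>. fst x < fst y \<longrightarrow> snd x < snd y)"

text \<open>Truncated subtraction is harmless here: an upper end \<open>0 - 1 = 0\<close> lies below
  the lower end, which is at least \<open>1\<close>, so the interval is empty, as is the strict
  condition.\<close>

lemma mesh_box_disjoint_iff:
  "mesh_box \<alpha> \<beta> a b \<inter> S = {} \<longleftrightarrow>
    (\<forall>(k, r) \<in> S. \<not> (\<alpha> a < k \<and> k < \<alpha> (a + 1) \<and> \<beta> b < r \<and> r < \<beta> (b + 1)))"
proof -
  have "mesh_box \<alpha> \<beta> a b = {(k, r). \<alpha> a < k \<and> k < \<alpha> (a + 1) \<and> \<beta> b < r \<and> r < \<beta> (b + 1)}"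
    by (auto simp: mesh_box_def)
  then have "mesh_box \<alpha> \<beta> a b \<inter> S = {} \<longleftrightarrow>
      (\<forall>x \<in> S. x \<notin> {(k, r). \<alpha> a < k \<and> k < \<alpha> (a + 1) \<and> \<beta> b < r \<and> r < \<beta> (b + 1)})"
    by (simp only: Int_commute[of _ S] disjoint_iff Ball_def)
  also have "\<dots> \<longleftrightarrow> (\<forall>(k, r) \<in> S. \<not> (\<alpha> a < k \<and> k < \<alpha> (a + 1) \<and> \<beta> b < r \<and> r < \<beta> (b + 1)))"
    by (intro ball_cong refl) (simp only: split_paired_all mem_Collect_eq prod.case)
  finally show ?thesis .
qed

text \<open>Boxes \<open>(0, 1)\<close> and \<open>(0, 2)\<close> cover the region to the left of
  \<open>i\<close> and above \<open>p\<close>, apart from the row \<open>q\<close>; boxes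
  \<open>(2, 0)\<close> and \<open>(2, 1)\<close> cover the region to the right of \<open>j\<close>
  and below \<open>q\<close>, apart from the row \<open>p\<close>.\<close>

lemma outer_boxes_empty_iff:
  assumes perm: "is_perm \<pi>"
  shows "(i, p) \<in> plot \<pi> \<and> (j, q) \<in> plot \<pi> \<and> i < j \<and> p < q \<and>
      (\<forall>(a, b) \<in> {(0, 1), (0, 2), (2, 0), (2, 1)}.
        mesh_box ((!) [0, i, j, length \<pi> + 1]) ((!) [0, p, q, length \<pi> + 1]) a b \<inter> plot \<pi> = {})
    \<longleftrightarrow> i < j \<and> p < q \<and> lr_max \<pi> (i, p) \<and> rl_min \<pi> (j, q)"
    (is "?i \<and> ?j \<and> _ \<and> _ \<and> ?L \<longleftrightarrow> _")
proof (cases "?i \<and> ?j \<and> i < j \<and> p < q")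
  case True
  then have pts: "(i, p) \<in> plot \<pi>" "(j, q) \<in> plot \<pi>" and ord: "i < j" "p < q"
    by simp_all
  have pt: "\<not> (0 < k \<and> k < i \<and> p < r \<and> r < q) \<and> \<not> (0 < k \<and> k < i \<and> q < r \<and> r < length \<pi> + 1) \<and>
    \<not> (j < k \<and> k < length \<pi> + 1 \<and> 0 < r \<and> r < p) \<and> \<not> (j < k \<and> k < length \<pi> + 1 \<and> p < r \<and> r < q)
    \<longleftrightarrow> (k < i \<longrightarrow> r < p) \<and> (j < k \<longrightarrow> q < r)" if kr: "(k, r) \<in> plot \<pi>" for k r
  proof -
    \<comment> \<open>The rows \<open>p\<close> and \<open>q\<close> belong to no box. By
      injectivity each holds a single point, and neither of these lies to the left of
      \<open>i\<close> or to the right of \<open>j\<close>.\<close>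
    have "k = i \<or> r \<noteq> p" "k = j \<or> r \<noteq> q"
      using plot_injective[OF perm] pts kr by auto
    then show ?thesis
      using plot_bounds[OF perm kr] ord by auto
  qed
  have "?L \<longleftrightarrow> (\<forall>(k, r) \<in> plot \<pi>.
    \<not> (0 < k \<and> k < i \<and> p < r \<and> r < q) \<and> \<not> (0 < k \<and> k < i \<and> q < r \<and> r < length \<pi> + 1) \<and>
    \<not> (j < k \<and> k < length \<pi> + 1 \<and> 0 < r \<and> r < p) \<and> \<not> (j < k \<and> k < length \<pi> + 1 \<and> p < r \<and> r < q))"
    unfolding mesh_box_disjoint_iff by (auto simp: eval_nat_numeral)
  also have "\<dots> \<longleftrightarrow> (\<forall>(k, r) \<in> plot \<pi>. (k < i \<longrightarrow> r < p) \<and> (j < k \<longrightarrow> q < r))"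
    by (intro ball_cong refl) (simp only: split_paired_all prod.case pt)
  also have "\<dots> \<longleftrightarrow> lr_max \<pi> (i, p) \<and> rl_min \<pi> (j, q)"
    unfolding lr_max_def rl_min_def using pts by auto
  finally have "?L \<longleftrightarrow> lr_max \<pi> (i, p) \<and> rl_min \<pi> (j, q)" .
  with True show ?thesis by argo
next
  case False
  moreover have "lr_max \<pi> (i, p) \<Longrightarrow> ?i" "rl_min \<pi> (j, q) \<Longrightarrow> ?j"
    by (simp_all add: lr_max_def rl_min_def)
  ultimately show ?thesis by argo
qed

lemma avoids_m1_iff:
  assumes "is_perm \<pi>"
  shows "avoids \<pi> m1 \<longleftrightarrow> \<not> (\<exists>i j p q. i < j \<and> p < q \<and> lr_max \<pi> (i, p) \<and> rl_min \<pi> (j, q))"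
proof -
  have "{(0, 1), (0, 2), (2, 0), (2, 1)} \<subseteq> {0..2::nat} \<times> {0..2::nat}" by auto
  note avoids = avoids_12_iff[OF assms this]
  show ?thesis
    unfolding m1_def avoids
    by (rule arg_cong[where f = Not], (rule ex_cong1)+, rule outer_boxes_empty_iff[OF assms])
qed

lemma avoids_m2_iff:
  assumes "is_perm \<pi>"
  shows "avoids \<pi> m2 \<longleftrightarrow> \<not> (\<exists>i j p q. i < j \<and> p < q \<and> lr_max \<pi> (i, p) \<and> rl_min \<pi> (j, q) \<and>
    (\<forall>(k, r) \<in> plot \<pi>. \<not> (i < k \<and> k < j \<and> p < r \<and> r < q)))"
proof -
  let ?R = "{(0, 1), (0, 2), (2, 0), (2, 1)} :: (nat \<times> nat) set"
  \<comment> \<open>Splitting off \<open>(1, 1)\<close> leaves exactly the shading of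
    \<open>m1\<close>, to which \<open>outer_boxes_empty_iff\<close> applies.\<close>
  have m2: "m2 = ([1, 2], insert (1, 1) ?R)"
    by (auto simp: m2_def)
  have "insert (1, 1) ?R \<subseteq> {0..2} \<times> {0..2}" by auto
  note avoids = avoids_12_iff[OF assms this]
  have mid: "mesh_box ((!) [0, i, j, n + 1]) ((!) [0, p, q, n + 1]) 1 1 \<inter> plot \<pi> = {} \<longleftrightarrow>
      (\<forall>(k, r) \<in> plot \<pi>. \<not> (i < k \<and> k < j \<and> p < r \<and> r < q))" for i j p q n
    unfolding mesh_box_disjoint_iff by (auto simp: eval_nat_numeral)
  have points: "(i, p) \<in> plot \<pi> \<and> (j, q) \<in> plot \<pi> \<and> i < j \<and> p < q \<and>
      (\<forall>(a, b) \<in> insert (1, 1) ?R.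
        mesh_box ((!) [0, i, j, length \<pi> + 1]) ((!) [0, p, q, length \<pi> + 1]) a b \<inter> plot \<pi> = {})
    \<longleftrightarrow> i < j \<and> p < q \<and> lr_max \<pi> (i, p) \<and> rl_min \<pi> (j, q) \<and>
      (\<forall>(k, r) \<in> plot \<pi>. \<not> (i < k \<and> k < j \<and> p < r \<and> r < q))"
    (is "?i \<and> ?j \<and> _ \<and> _ \<and> ?boxes \<longleftrightarrow> _ \<and> _ \<and> _ \<and> _ \<and> ?middle") for i j p q
  proof -
    let ?outer = "\<forall>(a, b) \<in> ?R.
      mesh_box ((!) [0, i, j, length \<pi> + 1]) ((!) [0, p, q, length \<pi> + 1]) a b \<inter> plot \<pi> = {}"
    have "?boxes \<longleftrightarrow> ?middle \<and> ?outer"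
      by (rule trans[OF ball_simps(7)]) (simp only: prod.case mid)
    moreover have "?i \<and> ?j \<and> i < j \<and> p < q \<and> ?outer \<longleftrightarrow>
        i < j \<and> p < q \<and> lr_max \<pi> (i, p) \<and> rl_min \<pi> (j, q)"
      by (rule outer_boxes_empty_iff[OF assms])
    ultimately show ?thesis by argo
  qed
  show ?thesis
    unfolding m2 avoids by (rule arg_cong[where f = Not], (rule ex_cong1)+, rule points)
qed

section \<open>Consequences of avoiding 321\<close>

lemma lr_max_or_rl_min:
  assumes perm: "is_perm \<pi>" and av: "avoids \<pi> (classical [3, 2, 1])" and x: "(k, r) \<in> plot \<pi>"
  shows "lr_max \<pi> (k, r) \<or> rl_min \<pi> (k, r)"
proof (rule ccontr)
  assume "\<not> ?thesis"
  then obtain i p j q where y: "(i, p) \<in> plot \<pi>" "i < k" "\<not> p < r"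
    and z: "(j, q) \<in> plot \<pi>" "k < j" "\<not> r < q"
    using x by (auto simp: lr_max_def rl_min_def)
  \<comment> \<open>The negated conditions give only \<open>r \<le> p\<close> and
    \<open>q \<le> r\<close>; a 321 formed with \<open>(k, r)\<close> in the middle needs strict
    inequalities.\<close>
  have "p \<noteq> r" "q \<noteq> r"
    using plot_injective[OF perm] x y z by blast+
  then show False
    using not_avoids_classical_321[OF perm y(1) x z(1)] av y z by simp
qed

lemma m1_occurrence_imp_m2_occurrence:
  assumes perm: "is_perm \<pi>" and av: "avoids \<pi> (classical [3, 2, 1])"
    and "i < j" "p < q" "lr_max \<pi> (i, p)" "rl_min \<pi> (j, q)"
  shows "\<exists>i j p q. i < j \<and> p < q \<and> lr_max \<pi> (i, p) \<and> rl_min \<pi> (j, q) \<and>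
    (\<forall>(k, r) \<in> plot \<pi>. \<not> (i < k \<and> k < j \<and> p < r \<and> r < q))"
  using assms(3-)
\<comment> \<open>Descent on the horizontal distance. A point in the middle rectangle has
  \<open>i < k < j\<close>, so it shortens the distance whichever end it replaces, and
  \<open>p < r < q\<close> keeps the new pair increasing.\<close>
proof (induction "j - i" arbitrary: i j p q rule: less_induct)
  case less
  show ?case
  proof (cases "\<forall>(k, r) \<in> plot \<pi>. \<not> (i < k \<and> k < j \<and> p < r \<and> r < q)")
    case True
    with less.prems show ?thesis by blast
  next
    case False
    then obtain k r where x: "(k, r) \<in> plot \<pi>" and kr: "i < k" "k < j" "p < r" "r < q"
      by auto
    from lr_max_or_rl_min[OF perm av x] show ?thesis
    proof
      \<comment> \<open>The new point takes over as lower left point; in the other case it becomes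
        the upper right one.\<close>
      assume "lr_max \<pi> (k, r)"
      then show ?thesis
        using less.hyps[of j k r q] less.prems kr by simp
    next
      assume "rl_min \<pi> (k, r)"
      then show ?thesis
        using less.hyps[of k i p r] less.prems kr by simp
    qed
  qed
qed

theorem mainTheorem12:
  shows "Av {classical [3, 2, 1], m1} = Av {classical [3, 2, 1], m2}"
proof -
  \<comment> \<open>From right to left this is the descent; from left to right the condition on the
    middle rectangle is simply dropped.\<close>
  have "avoids \<pi> m1 \<longleftrightarrow> avoids \<pi> m2" if "is_perm \<pi>" "avoids \<pi> (classical [3, 2, 1])" for \<pi>
    unfolding avoids_m1_iff[OF that(1)] avoids_m2_iff[OF that(1)]
    using m1_occurrence_imp_m2_occurrence[OF that] by blast
  then show ?thesis
    unfolding Av_def by blast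
qed

end
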